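(* Let $\widehat E=E+\varepsilon E_0$ and $\widehat F=F+\varepsilon F_0$ be elements of $\mathbb{D}_n^{\rm CM}$. Then $\widehat E\overset{{\rm G}\text{-}\#}{\leq}\widehat F$ (G-sharp partial order) if and only if $\widehat E\overset{\rm D}{\leq}\widehat F$ (Dual-minus partial order) and $$EF=FE,\qquad (F_0-E_0)EE^{\#}=O,\qquad EE^{\#}(F_0-E_0)=O.$$
   Context: $\varepsilon$ is the dual unit: $\varepsilon\neq 0$, $\varepsilon^2=0$, commuting with reals. $\mathbb{D}^{m\times n}$ is the set of $m\times n$ dual matrices $\widehat E=E+\varepsilon E_0$ with $E,E_0\in\mathbb{R}^{m\times n}$, with the obvious addition, multiplication and transpose $\widehat E^{T}=E^T+\varepsilon E_0^T$. The dual Moore-Penrose generalized inverse (DMPGI) of $\widehat E\in\mathbb{D}^{m\times n}$ is the unique $\widehat X\in\mathbb{D}^{n\times m}$, if it exists, with $\widehat E\widehat X\widehat E=\widehat E$, $\widehat X\widehat E\widehat X=\widehat X$, $(\widehat E\widehat X)^T=\widehat E\widehat X$, $(\widehat X\widehat E)^T=\widehat X\widehat E$. The dual group generalized inverse (DGGI) of $\widehat E\in\mathbb{D}^{n\times n}$ is the $\widehat X\in\mathbb{D}^{n\times n}$, if it exists, with $\widehat E\widehat X\widehat E=\widehat E$, $\widehat X\widehat E\widehat X=\widehat X$, $\widehat E\widehat X=\widehat X\widehat E$. $\mathbb{D}_n^{\rm CM}$ is the set of dual matrices in $\mathbb{D}^{n\times n}$ of dual index one, i.e. (equivalently) those whose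 DGGI exists; for $\widehat E=E+\varepsilon E_0\in\mathbb{D}_n^{\rm CM}$ the DMPGI of $\widehat E$ exists, and the ordinary group inverse $E^{\#}$ of the real matrix $E$ (the unique $X$ with $EXE=E$, $XEX=X$, $EX=XE$) exists. The group dual generalized inverse of such $\widehat E$ is $\widehat E^{g}=E^{\#}-\varepsilon E^{\#}E_0E^{\#}$. Minus partial order on real matrices of the same size: $E\leq F$ means $\mathrm{rk}(F-E)=\mathrm{rk}(F)-\mathrm{rk}(E)$. Dual-minus partial order: for dual matrices $\widehat E,\widehat F$ of the same size whose DMPGIs exist, $\widehat E\overset{\rm D}{\leq}\widehat F$ means that $E\leq F$ and the DMPGI of $\widehat F-\widehat E$ exists. G-sharp partial order: for $\widehat E,\widehat F\in\mathbb{D}_n^{\rm CM}$, $\widehat E\overset{{\rm G}\text{-}\#}{\leq}\widehat F$ means $\widehat E^{g}\widehat E=\widehat E^{g}\widehat F$ and $\widehat E\widehat E^{g}=\widehat F\widehat E^{g}$. *)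

theory Defs
  imports "HOL-Analysis.Analysis"
begin

section \<open>Dual numbers\<close>

datatype dual = Dual (std: real) (infpart: real)

instantiation dual :: comm_ring_1
begin

definition "0 = Dual 0 0"
definition "1 = Dual 1 0"
definition "x + y = Dual (std x + std y) (infpart x + infpart y)"
definition "- x = Dual (- std x) (- infpart x)"
definition "x - y = Dual (std x - std y) (infpart x - infpart y)"
definition "x * y = Dual (std x * std y) (std x * infpart y + infpart x * std y)"

instance
  by standard
    (auto simp: zero_dual_def one_dual_def plus_dual_def uminus_dual_def minus_dual_def
      times_dual_def algebra_simps)

end

definition dual_unit :: dual ("\<epsilon>")
  where "\<epsilon> = Dual 0 1"

lemma dual_unit_nonzero: "\<epsilon> \<noteq> 0"
  by (simp add: dual_unit_def zero_dual_def)

lemma dual_unit_square: "\<epsilon> * \<epsilon> = 0"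
  by (simp add: dual_unit_def zero_dual_def times_dual_def)

lemma Dual_eq: "Dual a b = Dual a 0 + \<epsilon> * Dual b 0"
  by (simp add: dual_unit_def plus_dual_def times_dual_def)


section \<open>Dual matrices\<close>

text \<open>The dual matrix \<open>E + \<epsilon> E0\<close>.\<close>

definition dual_matrix :: "real^'n^'m \<Rightarrow> real^'n^'m \<Rightarrow> dual^'n^'m"
  where "dual_matrix E E0 = (\<chi> i j. Dual (E $ i $ j) (E0 $ i $ j))"

definition std_matrix :: "dual^'n^'m \<Rightarrow> real^'n^'m"
  where "std_matrix A = (\<chi> i j. std (A $ i $ j))"

definition inf_matrix :: "dual^'n^'m \<Rightarrow> real^'n^'m"
  where "inf_matrix A = (\<chi> i j. infpart (A $ i $ j))"

lemma std_dual_matrix [simp]: "std_matrix (dual_matrix E E0) = E"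
  by (simp add: std_matrix_def dual_matrix_def vec_eq_iff)

lemma inf_dual_matrix [simp]: "inf_matrix (dual_matrix E E0) = E0"
  by (simp add: inf_matrix_def dual_matrix_def vec_eq_iff)

lemma dual_matrix_std_inf [simp]: "dual_matrix (std_matrix A) (inf_matrix A) = A"
  by (simp add: std_matrix_def inf_matrix_def dual_matrix_def vec_eq_iff)

lemma dual_matrix_add:
  "dual_matrix E E0 + dual_matrix F F0 = dual_matrix (E + F) (E0 + F0)"
  by (simp add: dual_matrix_def vec_eq_iff plus_dual_def)

lemma dual_matrix_diff:
  "dual_matrix E E0 - dual_matrix F F0 = dual_matrix (E - F) (E0 - F0)"
  by (simp add: dual_matrix_def vec_eq_iff minus_dual_def)

lemma dual_matrix_transpose:
  "transpose (dual_matrix E E0) = dual_matrix (transpose E) (transpose E0)"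
  by (simp add: dual_matrix_def vec_eq_iff transpose_def)

lemma Dual_sum: "(\<Sum>k\<in>K. Dual (f k) (g k)) = Dual (\<Sum>k\<in>K. f k) (\<Sum>k\<in>K. g k)"
  by (induction K rule: infinite_finite_induct) (auto simp: zero_dual_def plus_dual_def)

lemma dual_matrix_mult:
  "dual_matrix E E0 ** dual_matrix F F0 = dual_matrix (E ** F) (E ** F0 + E0 ** F)"
  by (simp add: dual_matrix_def vec_eq_iff matrix_matrix_mult_def times_dual_def Dual_sum
      sum.distrib)


section \<open>Generalized inverses\<close>

definition is_DMPGI :: "dual^'n^'m \<Rightarrow> dual^'m^'n \<Rightarrow> bool"
  where "is_DMPGI A X \<longleftrightarrow>
    A ** X ** A = A \<and> X ** A ** X = X \<and>
    transpose (A ** X) = A ** X \<and> transpose (X ** A) = X ** A"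

definition has_DMPGI :: "dual^'n^'m \<Rightarrow> bool"
  where "has_DMPGI A \<longleftrightarrow> (\<exists>X. is_DMPGI A X)"

text \<open>For \<open>'a = real\<close> this is the ordinary group inverse, for \<open>'a = dual\<close> the dual group
  generalized inverse (DGGI).\<close>

definition is_group_inverse :: "'a::comm_ring_1^'n^'n \<Rightarrow> 'a^'n^'n \<Rightarrow> bool"
  where "is_group_inverse A X \<longleftrightarrow>
    A ** X ** A = A \<and> X ** A ** X = X \<and> A ** X = X ** A"

text \<open>Only meaningful if the group inverse exists (it is then unique).\<close>

definition group_inverse :: "real^'n^'n \<Rightarrow> real^'n^'n"  ("_\<^sup>#" [1000] 999)
  where "E\<^sup># = (THE X. is_group_inverse E X)"

text \<open>The set of dual matrices of dual index one, described by existence of the DGGI.\<close>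

definition dual_CM :: "(dual^'n^'n) set"
  where "dual_CM = {A. \<exists>X. is_group_inverse A X}"

text \<open>The group dual generalized inverse \<open>E\<^sup># - \<epsilon> E\<^sup># E0 E\<^sup>#\<close> of \<open>E + \<epsilon> E0\<close> in \<^const>\<open>dual_CM\<close>.\<close>

definition group_dual_inverse :: "dual^'n^'n \<Rightarrow> dual^'n^'n"  ("_\<^sup>g" [1000] 999)
  where "A\<^sup>g = dual_matrix ((std_matrix A)\<^sup>#)
    (- ((std_matrix A)\<^sup># ** inf_matrix A ** (std_matrix A)\<^sup>#))"


section \<open>Partial orders\<close>

text \<open>The rank difference is taken in the integers, so it is not truncated.\<close>

definition minus_le :: "real^'n^'m \<Rightarrow> real^'n^'m \<Rightarrow> bool"  (infix "\<le>\<^sup>-" 50)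
  where "E \<le>\<^sup>- F \<longleftrightarrow> int (rank (F - E)) = int (rank F) - int (rank E)"

text \<open>The two orders on dual matrices are only defined on a domain (existence of the DMPGI,
  respectively dual index one); membership in the domain is made part of the relation.\<close>

definition dual_minus_le :: "dual^'n^'m \<Rightarrow> dual^'n^'m \<Rightarrow> bool"  (infix "\<le>\<^sup>D" 50)
  where "A \<le>\<^sup>D B \<longleftrightarrow> has_DMPGI A \<and> has_DMPGI B \<and>
    std_matrix A \<le>\<^sup>- std_matrix B \<and> has_DMPGI (B - A)"

definition G_sharp_le :: "dual^'n^'n \<Rightarrow> dual^'n^'n \<Rightarrow> bool"  (infix "\<le>\<^sup>G\<^sup>#" 50)
  where "A \<le>\<^sup>G\<^sup># B \<longleftrightarrow> A \<in> dual_CM \<and> B \<in> dual_CM \<and>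
    A\<^sup>g ** A = A\<^sup>g ** B \<and> A ** A\<^sup>g = B ** A\<^sup>g"

end

theory Submission
  imports Defs
begin

text \<open>Put \<open>P = E ** E\<^sup>#\<close> and \<open>D0 = F0 - E0\<close>. Comparing standard and infinitesimal parts, the G-sharp
  order amounts to \<open>E ** F = E ** E = F ** E\<close>, \<open>P ** D0 = 0\<close> and \<open>D0 ** P = 0\<close>. For commuting real
  \<open>E\<close> and \<open>F\<close> of index one, the first condition is equivalent to the minus order, since rank
  additivity means that the column space of \<open>F\<close> is the direct sum of those of \<open>E\<close> and \<open>F - E\<close>.

  It remains to see that the DMPGI of the difference then exists automatically. A dual matrix has a
  DMPGI as soon as it has an inner inverse. With \<open>H = F\<^sup># - E\<^sup>#\<close>, the matrix \<open>H - \<epsilon> H D0 H\<close> is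
  an inner inverse of \<open>(F - E) + \<epsilon> D0\<close>, because index one forces \<open>(I - P) E0 (I - P) = 0\<close> and
  likewise for \<open>F\<close>.\<close>

section \<open>Algebra of matrices and their dual parts\<close>

lemma matrix_mult_add_distrib_right: "(A + B) ** C = A ** C + B ** C"
  for A B :: "'a::semiring_1^'n^'m" and C :: "'a^'p^'n"
  by (simp add: matrix_matrix_mult_def vec_eq_iff sum.distrib algebra_simps)

lemma matrix_mult_diff_distrib_right: "(A - B) ** C = A ** C - B ** C"
  for A B :: "'a::ring_1^'n^'m" and C :: "'a^'p^'n"
  by (simp add: matrix_matrix_mult_def vec_eq_iff sum_subtractf algebra_simps)

lemma matrix_mult_diff_distrib_left: "A ** (B - C) = A ** B - A ** C"
  for A :: "'a::ring_1^'n^'m" and B C :: "'a^'p^'n"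
  by (simp add: matrix_matrix_mult_def vec_eq_iff sum_subtractf algebra_simps)

lemmas matrix_distribs = matrix_add_ldistrib matrix_mult_add_distrib_right
  matrix_mult_diff_distrib_left matrix_mult_diff_distrib_right

lemma matrix_mult_minus_left [simp]: "(- A) ** B = - (A ** B)"
  for A :: "'a::ring_1^'n^'m" and B :: "'a^'p^'n"
  by (simp add: matrix_matrix_mult_def vec_eq_iff sum_negf)

lemma matrix_mult_minus_right [simp]: "A ** (- B) = - (A ** B)"
  for A :: "'a::ring_1^'n^'m" and B :: "'a^'p^'n"
  by (simp add: matrix_matrix_mult_def vec_eq_iff sum_negf)

lemma transpose_add: "transpose (A + B) = transpose A + transpose B"
  for A B :: "'a::ab_group_add^'n^'m"
  by (simp add: transpose_def vec_eq_iff)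

lemma transpose_diff: "transpose (A - B) = transpose A - transpose B"
  for A B :: "'a::ab_group_add^'n^'m"
  by (simp add: transpose_def vec_eq_iff)

lemma dual_matrix_mat_1: "dual_matrix (mat 1) 0 = mat 1"
  by (simp add: dual_matrix_def vec_eq_iff mat_def one_dual_def zero_dual_def)

lemma dual_matrix_eq_iff: "dual_matrix E E0 = dual_matrix F F0 \<longleftrightarrow> E = F \<and> E0 = F0"
  by (metis inf_dual_matrix std_dual_matrix)

subsection \<open>Regular dual matrices have a Moore-Penrose inverse\<close>

text \<open>Since \<epsilon> squares to zero, the Neumann series of the inverse stops after its
  linear term.\<close>

lemma invertible_dual_matrix:
  assumes "invertible S"
  shows "invertible (dual_matrix S S0)"
proof -
  obtain T where T: "S ** T = mat 1" "T ** S = mat 1"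
    using assms by (auto simp: invertible_def)
  have "dual_matrix S S0 ** dual_matrix T (- (T ** S0 ** T)) = mat 1"
    by (simp add: dual_matrix_mult matrix_mul_assoc T dual_matrix_mat_1)
  moreover have "dual_matrix T (- (T ** S0 ** T)) ** dual_matrix S S0 = mat 1"
    by (simp add: dual_matrix_mult matrix_mul_assoc[symmetric] T dual_matrix_mat_1)
  ultimately show ?thesis
    by (auto simp: invertible_def)
qed

text \<open>The quadratic form of the matrix at \<open>x\<close> is the sum of the squared norms of
  \<open>x\<close> and \<open>M *v x\<close>, so the kernel is trivial.\<close>

lemma invertible_one_plus_gram:
  fixes M :: "real^'n^'m"
  shows "invertible (mat 1 + transpose M ** M)"
proof -
  have "x = 0" if "(mat 1 + transpose M ** M) *v x = 0" for x
  proof -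
    have "x \<bullet> ((mat 1 + transpose M ** M) *v x) = x \<bullet> x + (M *v x) \<bullet> (M *v x)"
      by (simp add: matrix_vector_mult_add_rdistrib inner_add_right dot_lmul_matrix
          flip: matrix_vector_mul_assoc del: transpose_matrix_vector)
        (metis dot_lmul_matrix inner_commute transpose_matrix_vector)
    then have "x \<bullet> x + (M *v x) \<bullet> (M *v x) = 0"
      using that by simp
    then show ?thesis
      by (metis add_nonneg_eq_0_iff inner_eq_zero_iff inner_ge_zero)
  qed
  then show ?thesis
    by (metis invertible_left_inverse matrix_left_invertible_ker)
qed

text \<open>Kaplansky's trick: the orthogonal projector onto the range of the idempotent
  \<open>Q = A ** Y\<close> is \<open>Q ** Q\<^sup>T ** W\<^sup>-\<^sup>1\<close> with \<open>W = I - (Q - Q\<^sup>T)\<^sup>2\<close>, because \<open>W\<close> commutes with \<open>Q\<close> and \<open>Q\<^sup>T\<close>.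
  The standard part of \<open>W\<close> has the form \<open>I + M\<^sup>T ** M\<close>, so \<open>W\<close> is invertible.\<close>

lemma regular_dual_matrix_least_squares_inverse:
  fixes A :: "dual^'n^'m"
  assumes AYA: "A ** Y ** A = A"
  obtains X where "A ** X ** A = A" "transpose (A ** X) = A ** X"
proof -
  define Q where "Q = A ** Y"
  define T where "T = transpose Q"
  define W where "W = mat 1 + transpose (Q - T) ** (Q - T)"
  have tQ: "transpose Q = T" "transpose T = Q"
    by (simp_all add: T_def)
  have QA: "Q ** A = A" and QQ: "Q ** Q = Q"
    using AYA by (simp_all add: Q_def matrix_mul_assoc)
  have TT: "T ** T = T"
    using QQ unfolding T_def by (metis matrix_transpose_mul)
  have absorb: "X ** Q ** Q = X ** Q" "X ** T ** T = X ** T" for X :: "dual^'m^'m"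
    by (simp_all add: QQ TT flip: matrix_mul_assoc)
  have W: "W = mat 1 - T - Q + T ** Q + Q ** T"
    by (simp add: W_def transpose_diff tQ matrix_distribs QQ TT)
  have QW: "Q ** W = Q ** T ** Q" and WQ: "W ** Q = Q ** T ** Q"
    by (simp_all add: W matrix_distribs QQ absorb matrix_mul_assoc)
  have TW: "T ** W = T ** Q ** T" and WT: "W ** T = T ** Q ** T"
    by (simp_all add: W matrix_distribs TT absorb matrix_mul_assoc)
  have tW: "transpose W = W"
    by (simp add: W transpose_diff transpose_add matrix_transpose_mul tQ transpose_mat)
  define M M0 where "M = std_matrix (Q - T)" and "M0 = inf_matrix (Q - T)"
  have "Q - T = dual_matrix M M0"
    by (simp add: M_def M0_def)
  then have "W = dual_matrix (mat 1 + transpose M ** M) (transpose M ** M0 + transpose M0 ** M)"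
    by (simp add: W_def dual_matrix_transpose dual_matrix_mult dual_matrix_add
        flip: dual_matrix_mat_1)
  then have "invertible W"
    by (simp add: invertible_dual_matrix invertible_one_plus_gram)
  then obtain V where V: "W ** V = mat 1" "V ** W = mat 1"
    by (auto simp: invertible_def)
  have tV: "transpose V = V"
    by (metis V tW matrix_mul_assoc matrix_mul_lid matrix_mul_rid matrix_transpose_mul transpose_mat)
  have comm: "V ** B = B ** V" if "B ** W = W ** B" for B
    by (metis V that matrix_mul_assoc matrix_mul_lid matrix_mul_rid)
  have VQ: "V ** Q = Q ** V" and VT: "V ** T = T ** V"
    using QW WQ TW WT comm by simp_all
  \<comment> \<open>Moving \<open>V\<close> to the right past \<open>Q\<close> turns the left side
    into \<open>Q ** W ** V\<close>.\<close>
  have PQ: "Q ** T ** V ** Q = Q"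
    by (metis QW V(1) VQ matrix_mul_assoc matrix_mul_rid)
  show ?thesis
  proof
    have eq: "A ** (Y ** T ** V) = Q ** T ** V"
      by (simp add: Q_def matrix_mul_assoc)
    show "A ** (Y ** T ** V) ** A = A"
      unfolding eq by (metis PQ QA matrix_mul_assoc)
    show "transpose (A ** (Y ** T ** V)) = A ** (Y ** T ** V)"
      unfolding eq by (simp add: matrix_transpose_mul tQ tV) (metis VQ VT matrix_mul_assoc)
  qed
qed

text \<open>Urquhart's formula: \<open>X\<close> makes \<open>A ** X\<close> symmetric, the
  transposed construction gives \<open>U\<close> with \<open>U ** A\<close> symmetric, and
  \<open>U ** A ** X\<close> inherits both properties.\<close>

lemma regular_imp_has_DMPGI:
  assumes AYA: "A ** Y ** A = A"
  shows "has_DMPGI A"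
proof -
  obtain X where X: "A ** X ** A = A" "transpose (A ** X) = A ** X"
    using regular_dual_matrix_least_squares_inverse[OF AYA] .
  have "transpose A ** transpose Y ** transpose A = transpose A"
    using AYA by (metis matrix_transpose_mul matrix_mul_assoc)
  then obtain Z where Z: "transpose A ** Z ** transpose A = transpose A"
      "transpose (transpose A ** Z) = transpose A ** Z"
    by (rule regular_dual_matrix_least_squares_inverse)
  define U where "U = transpose Z"
  have U: "A ** U ** A = A" "transpose (U ** A) = U ** A"
    using Z by (simp_all add: U_def matrix_transpose_mul matrix_mul_assoc)
      (metis matrix_transpose_mul matrix_mul_assoc transpose_transpose)+
  have "A ** (U ** A ** X) = A ** X" "U ** A ** X ** A = U ** A"
    using X U by (simp_all add: matrix_mul_assoc) (metis X(1) matrix_mul_assoc)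
  moreover have "U ** A ** (U ** A ** X) = U ** A ** X"
    using U by (metis matrix_mul_assoc)
  ultimately have "is_DMPGI A (U ** A ** X)"
    using X U unfolding is_DMPGI_def by simp
  then show ?thesis
    by (auto simp: has_DMPGI_def)
qed

subsection \<open>Group inverses\<close>

text \<open>By commutation, \<open>A ** Y ** A ** X\<close> equals both \<open>A ** X\<close> and
  \<open>A ** Y\<close>.\<close>

lemma group_inverse_unique:
  assumes "is_group_inverse A X" "is_group_inverse A Y"
  shows "X = Y"
proof -
  have X: "A ** X ** A = A" "X ** A ** X = X" "A ** X = X ** A"
    and Y: "A ** Y ** A = A" "Y ** A ** Y = Y" "A ** Y = Y ** A"
    using assms by (auto simp: is_group_inverse_def)
  have "A ** X = A ** Y"
    by (metis X(1,3) Y(1,3) matrix_mul_assoc)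
  then show ?thesis
    by (metis X(2,3) Y(2,3) matrix_mul_assoc)
qed

lemma group_inverse_eq: "is_group_inverse E X \<Longrightarrow> E\<^sup># = X"
  unfolding group_inverse_def by (blast intro: group_inverse_unique)

text \<open>Both products reduce to \<open>K ** F ** E ** K\<close>: insert the projector
  \<open>F ** K = K ** F\<close>, which fixes \<open>F\<close> and \<open>K\<close>, and move
  \<open>E\<close> across \<open>F\<close>.\<close>

lemma group_inverse_commute:
  assumes "is_group_inverse F K" and EF: "E ** F = F ** E"
  shows "E ** K = K ** E"
proof -
  have K: "F ** K ** F = F" "K ** F ** K = K" "F ** K = K ** F"
    using assms by (auto simp: is_group_inverse_def)
  have FFK: "F ** F ** K = F"
    by (metis K(1,3) matrix_mul_assoc)
  have KFF: "K ** F ** F = F"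
    by (metis K(1,3))
  have FKK: "F ** K ** K = K" and KKF: "K ** K ** F = K"
    by (metis K(2,3) matrix_mul_assoc)+
  have "E ** K = E ** F ** K ** K"
    by (metis FKK matrix_mul_assoc)
  also have "\<dots> = K ** F ** F ** E ** K ** K"
    by (simp add: KFF EF)
  also have "\<dots> = K ** F ** E ** F ** K ** K"
    by (metis EF matrix_mul_assoc)
  also have "\<dots> = K ** F ** E ** K"
    by (metis FKK matrix_mul_assoc)
  also have "\<dots> = K ** K ** F ** F ** E ** K"
    by (simp add: KKF)
  also have "\<dots> = K ** K ** E ** F ** F ** K"
    by (metis EF matrix_mul_assoc)
  also have "\<dots> = K ** K ** E ** F"
    by (metis FFK matrix_mul_assoc)
  also have "\<dots> = K ** E"
    by (metis EF KKF matrix_mul_assoc)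
  finally show ?thesis .
qed

lemma dual_CM_E:
  assumes "dual_matrix E E0 \<in> dual_CM"
  obtains "has_DMPGI (dual_matrix E E0)" "is_group_inverse E (E\<^sup>#)"
    "(mat 1 - E ** E\<^sup>#) ** E0 ** (mat 1 - E ** E\<^sup>#) = 0"
proof -
  obtain Y where "is_group_inverse (dual_matrix E E0) Y"
    using assms by (auto simp: dual_CM_def)
  moreover obtain X X0 where "Y = dual_matrix X X0"
    by (metis dual_matrix_std_inf)
  ultimately have Y: "is_group_inverse (dual_matrix E E0) (dual_matrix X X0)"
    by simp
  then have X: "is_group_inverse E X"
    and E0: "E ** X ** E0 + (E ** X0 + E0 ** X) ** E = E0"
    unfolding is_group_inverse_def dual_matrix_mult dual_matrix_eq_iff by blast+
  have *: "(mat 1 - E ** X) ** E = 0" "E ** (mat 1 - E ** X) = 0"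
    using X by (auto simp: is_group_inverse_def matrix_distribs matrix_mul_assoc)
  \<comment> \<open>By \<open>E0\<close>, the infinitesimal part is a sum of terms that begin or end
    with \<open>E\<close>; the complementary projector kills each of them from one side.\<close>
  have "(mat 1 - E ** X) ** E0 ** (mat 1 - E ** X) =
      (mat 1 - E ** X) ** E ** (X ** E0 + X0 ** E) ** (mat 1 - E ** X)
      + (mat 1 - E ** X) ** E0 ** X ** (E ** (mat 1 - E ** X))"
    by (subst E0[symmetric], simp only: matrix_distribs matrix_mul_assoc) (simp add: algebra_simps)
  then have "(mat 1 - E ** X) ** E0 ** (mat 1 - E ** X) = 0"
    by (simp add: *)
  moreover have "has_DMPGI (dual_matrix E E0)"
    using Y by (auto simp: is_group_inverse_def intro: regular_imp_has_DMPGI)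
  ultimately show ?thesis
    using X that by (simp add: group_inverse_eq)
qed

subsection \<open>The minus partial order and column spaces\<close>

lemma dim_range_sum:
  fixes E D :: "real^'n^'m"
  defines "S \<equiv> {x + y |x y. x \<in> range ((*v) E) \<and> y \<in> range ((*v) D)}"
  shows "dim S + dim (range ((*v) E) \<inter> range ((*v) D)) = rank E + rank D"
  unfolding S_def rank_dim_range
  by (rule dim_sums_Int) (auto intro!: linear_subspace_image)

text \<open>The column spaces of \<open>E\<close> and \<open>F - E\<close> together span a space
  containing that of \<open>F\<close>. Rank additivity leaves no room for an overlap or for a strict
  inclusion.\<close>

lemma minus_leD:
  fixes E F :: "real^'n^'m"
  assumes "E \<le>\<^sup>- F"
  shows "range ((*v) E) \<inter> range ((*v) (F - E)) = {0}"
    and "range ((*v) E) \<subseteq> range ((*v) F)"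
proof -
  define S where "S = {x + y |x y. x \<in> range ((*v) E) \<and> y \<in> range ((*v) (F - E))}"
  have S: "subspace S"
    unfolding S_def by (rule subspace_sums) (auto intro!: linear_subspace_image)
  have FS: "range ((*v) F) \<subseteq> S"
  proof (rule image_subsetI)
    fix x
    have "F *v x = E *v x + (F - E) *v x"
      by (simp add: matrix_vector_mult_diff_rdistrib)
    then show "F *v x \<in> S"
      unfolding S_def by blast
  qed
  have *: "dim S + dim (range ((*v) E) \<inter> range ((*v) (F - E))) = rank F"
    using dim_range_sum[of E "F - E"] assms by (simp add: S_def minus_le_def)
  have "rank F \<le> dim S"
    using FS by (simp add: rank_dim_range dim_subset)
  moreover have "dim S \<le> rank F"
    using * by simp
  ultimately have "dim S = rank F" and "dim (range ((*v) E) \<inter> range ((*v) (F - E))) = 0"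
    using * by simp_all
  then show "range ((*v) E) \<inter> range ((*v) (F - E)) = {0}"
    by (auto simp: dim_eq_0 intro: image_eqI[of _ _ 0])
  have "range ((*v) F) = S"
    using FS S \<open>dim S = rank F\<close>
    by (intro subspace_dim_equal) (auto intro!: linear_subspace_image simp: rank_dim_range)
  moreover have "range ((*v) E) \<subseteq> S"
    unfolding S_def by (force intro: image_eqI[of _ _ 0])
  ultimately show "range ((*v) E) \<subseteq> range ((*v) F)"
    by simp
qed

text \<open>\<open>P\<close> fixes the column space of \<open>E\<close> and kills that of
  \<open>F - E\<close>, so their sum is direct; \<open>Q\<close> puts the column space of
  \<open>E\<close> inside that of \<open>F\<close>, so the sum is all of it.\<close>

lemma minus_leI:
  fixes E F :: "real^'n^'m"
  assumes P: "P ** E = E" "P ** F = E" and Q: "F ** Q = E"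
  shows "E \<le>\<^sup>- F"
proof -
  define S where "S = {x + y |x y. x \<in> range ((*v) E) \<and> y \<in> range ((*v) (F - E))}"
  have "x = 0" if "x = E *v y" "x = (F - E) *v z" for x y z
  proof -
    have "P *v x = x"
      using that(1) P by (simp add: matrix_vector_mul_assoc)
    moreover have "P *v x = 0"
      using that(2) P by (simp add: matrix_vector_mul_assoc matrix_distribs)
    ultimately show ?thesis
      by simp
  qed
  then have "range ((*v) E) \<inter> range ((*v) (F - E)) \<subseteq> {0}"
    by blast
  then have "dim (range ((*v) E) \<inter> range ((*v) (F - E))) = 0"
    by (simp add: dim_eq_0)
  then have *: "dim S = rank E + rank (F - E)"
    using dim_range_sum[of E "F - E"] unfolding S_def by linarith
  have "E *v y + (F - E) *v z = F *v (Q *v y + z - Q *v z)" for y z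
    using Q by (simp add: matrix_vector_mult_diff_rdistrib matrix_vector_mult_diff_distrib
        matrix_vector_right_distrib matrix_vector_mul_assoc)
  then have "S \<subseteq> range ((*v) F)"
    by (auto simp: S_def)
  moreover have "range ((*v) F) \<subseteq> S"
  proof (rule image_subsetI)
    fix x
    have "F *v x = E *v x + (F - E) *v x"
      by (simp add: matrix_vector_mult_diff_rdistrib)
    then show "F *v x \<in> S"
      unfolding S_def by blast
  qed
  ultimately have "rank F = dim S"
    by (simp add: rank_dim_range)
  then show ?thesis
    using * by (simp add: minus_le_def)
qed

text \<open>The key is that \<open>K\<close> is also an inner inverse of \<open>E\<close>: then
  \<open>E ** F = E ** K ** F ** E\<close>, and \<open>E ** K ** F\<close> collapses to
  \<open>E\<close>.\<close>

lemma minus_le_commute_imp: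
  fixes E F :: "real^'n^'n"
  assumes le: "E \<le>\<^sup>- F" and EF: "E ** F = F ** E" and FK: "is_group_inverse F K"
  shows "E ** F = E ** E"
proof -
  have K: "F ** K ** F = F" "F ** K = K ** F"
    using FK by (auto simp: is_group_inverse_def)
  have EK: "E ** K = K ** E"
    using FK EF by (rule group_inverse_commute)
  have "F ** K ** E = E"
  proof (rule matrix_eq[THEN iffD2], rule allI)
    fix x
    obtain y where "E *v x = F *v y"
      using minus_leD(2)[OF le] by auto
    then show "(F ** K ** E) *v x = E *v x"
      using K by (metis matrix_vector_mul_assoc)
  qed
  then have EKF: "E ** K ** F = E"
    by (metis EF EK K(2) matrix_mul_assoc)
  \<comment> \<open>This puts \<open>E - E ** K ** E\<close> into the column spaces of both
    \<open>E\<close> and \<open>F - E\<close>, which meet only in zero.\<close>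
  have eq: "E ** (mat 1 - K ** E) = (F - E) ** (K ** E)"
    using EKF EK K EF by (simp add: matrix_distribs matrix_mul_assoc) (metis matrix_mul_assoc)
  have "E ** (mat 1 - K ** E) = 0"
  proof (rule matrix_eq[THEN iffD2], rule allI)
    fix x
    have "(E ** (mat 1 - K ** E)) *v x \<in> range ((*v) E) \<inter> range ((*v) (F - E))"
      by (metis IntI eq matrix_vector_mul_assoc rangeI)
    then show "(E ** (mat 1 - K ** E)) *v x = 0 *v x"
      using minus_leD(1)[OF le] by simp
  qed
  then have "E = E ** K ** E"
    by (simp add: matrix_distribs matrix_mul_assoc)
  then have "E ** F = E ** K ** F ** E"
    by (metis EF matrix_mul_assoc)
  then show ?thesis
    by (simp add: EKF)
qed

subsection \<open>The G-sharp partial order\<close>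

lemma G_sharp_le_iff:
  fixes E E0 F F0 :: "real^'n^'n"
  assumes "is_group_inverse E (E\<^sup>#)"
    and "dual_matrix E E0 \<in> dual_CM" and "dual_matrix F F0 \<in> dual_CM"
  shows "dual_matrix E E0 \<le>\<^sup>G\<^sup># dual_matrix F F0 \<longleftrightarrow>
    E ** F = E ** E \<and> F ** E = E ** E \<and>
    (F0 - E0) ** E ** E\<^sup># = 0 \<and> E ** E\<^sup># ** (F0 - E0) = 0"
proof -
  define G where "G = E\<^sup>#"
  have GE: "E ** G ** E = E" "G ** E ** G = G" "E ** G = G ** E"
    using assms(1) by (auto simp: is_group_inverse_def G_def)
  \<comment> \<open>As \<open>E ** E ** G = E\<close> and \<open>G ** G ** E = G\<close>,
    multiplying by the square of \<open>E\<close> or \<open>G\<close> passes between the two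
    forms.\<close>
  have 1: "G ** E = G ** F \<longleftrightarrow> E ** F = E ** E"
    by (metis GE matrix_mul_assoc)
  have 2: "E ** G = F ** G \<longleftrightarrow> F ** E = E ** E"
    by (metis GE matrix_mul_assoc)
  have 3: "E ** G ** (F0 - E0) = 0 \<longleftrightarrow> G ** E0 = G ** F0"
  proof -
    have "E ** G ** (F0 - E0) = 0 \<longleftrightarrow> G ** (F0 - E0) = 0"
      by (metis GE matrix_mul_assoc times0_right)
    then show ?thesis
      by (auto simp: matrix_distribs)
  qed
  have 4: "(F0 - E0) ** E ** G = 0 \<longleftrightarrow> E0 ** G = F0 ** G"
  proof -
    have "(F0 - E0) ** E ** G = 0 \<longleftrightarrow> (F0 - E0) ** G = 0"
      by (metis GE matrix_mul_assoc times0_left)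
    then show ?thesis
      by (auto simp: matrix_distribs)
  qed
  have "dual_matrix E E0 \<le>\<^sup>G\<^sup># dual_matrix F F0 \<longleftrightarrow>
    G ** E = G ** F \<and> E ** G = F ** G \<and>
    G ** E0 - G ** E0 ** G ** E = G ** F0 - G ** E0 ** G ** F \<and>
    E0 ** G - E ** G ** E0 ** G = F0 ** G - F ** G ** E0 ** G"
    using assms(2,3)
    by (auto simp: G_sharp_le_def group_dual_inverse_def dual_matrix_mult dual_matrix_eq_iff
        matrix_mul_assoc simp flip: G_def)
  \<comment> \<open>Once the standard parts agree, the terms with two factors \<open>G\<close>
    coincide and cancel.\<close>
  also have "\<dots> \<longleftrightarrow> G ** E = G ** F \<and> E ** G = F ** G \<and> G ** E0 = G ** F0 \<and> E0 ** G = F0 ** G"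
    by (metis (no_types, lifting) add_diff_cancel_left' diff_add_cancel matrix_mul_assoc)
  finally show ?thesis
    unfolding 1 2 using 3 4 by (auto simp: G_def)
qed

section \<open>Regularity of the difference\<close>

lemma sharp_imp_difference_regular:
  fixes E E0 F F0 :: "real^'n^'n"
  assumes "is_group_inverse E G" "is_group_inverse F K"
    and E0: "(mat 1 - E ** G) ** E0 ** (mat 1 - E ** G) = 0"
    and F0: "(mat 1 - F ** K) ** F0 ** (mat 1 - F ** K) = 0"
    and EF: "E ** F = E ** E" "F ** E = E ** E"
    and D: "(F0 - E0) ** E ** G = 0" "E ** G ** (F0 - E0) = 0"
  shows "has_DMPGI (dual_matrix (F - E) (F0 - E0))"
proof -
  have G: "E ** G ** E = E" "G ** E ** G = G" "E ** G = G ** E"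
    and K: "F ** K ** F = F" "K ** F ** K = K" "F ** K = K ** F"
    using assms by (auto simp: is_group_inverse_def)
  define P Q D0 H where "P = E ** G" and "Q = F ** K" and "D0 = F0 - E0" and "H = K - G"
  have FG: "F ** G = P" "G ** F = P"
    unfolding P_def by (metis EF G matrix_mul_assoc)+
  \<comment> \<open>\<open>E = E ** E ** G = F ** E ** G\<close> lies in the column space of
    \<open>F\<close>. The same identity then gives
    \<open>K ** E = K ** F ** E ** G = E ** G\<close>.\<close>
  have FKE: "F ** K ** E = E"
    by (metis EF G K matrix_mul_assoc)
  have KE: "K ** E = P"
    unfolding P_def by (metis FKE K EF G matrix_mul_assoc)
  have EK: "E ** K = P"
    using KE EF assms(2) group_inverse_commute by metis
  have DH: "(F - E) ** H = Q - P" and HD: "H ** (F - E) = Q - P"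
    by (simp_all add: H_def matrix_distribs FG KE EK Q_def K G flip: P_def)
      (simp_all add: P_def G K)
  have DHD: "(Q - P) ** (F - E) = F - E"
    using EF G K FKE FG by (simp add: P_def Q_def matrix_distribs matrix_mul_assoc)
       (metis EF G matrix_mul_assoc)
  have "Q ** P = P"
    by (simp add: P_def Q_def matrix_mul_assoc FKE)
  moreover have "P ** Q = P"
  proof -
    have "P ** Q = G ** (E ** F) ** K"
      by (simp add: P_def Q_def G matrix_mul_assoc)
    also have "\<dots> = (G ** E) ** (E ** K)"
      by (simp add: EF matrix_mul_assoc)
    also have "\<dots> = P"
      by (simp add: EK P_def G matrix_mul_assoc flip: G(3))
    finally show ?thesis .
  qed
  ultimately have QP: "Q ** P = P" "P ** Q = P"
    by simp_all
  have P0: "P ** D0 = 0" "D0 ** P = 0"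
    using D by (simp_all add: P_def D0_def matrix_mul_assoc)
  \<comment> \<open>Since \<open>mat 1 - Q\<close> absorbs \<open>mat 1 - P\<close>, the vanishing
    corner of \<open>E0\<close> passes from \<open>P\<close> to \<open>Q\<close>, where it can be
    compared with that of \<open>F0\<close>.\<close>
  have "(mat 1 - Q) ** E0 ** (mat 1 - Q)
      = (mat 1 - Q) ** ((mat 1 - P) ** E0 ** (mat 1 - P)) ** (mat 1 - Q)"
  proof -
    have "(mat 1 - Q) ** (mat 1 - P) = mat 1 - Q" "(mat 1 - P) ** (mat 1 - Q) = mat 1 - Q"
      by (simp_all add: matrix_distribs QP)
    then show ?thesis
      by (metis matrix_mul_assoc)
  qed
  then have "(mat 1 - Q) ** E0 ** (mat 1 - Q) = 0"
    using E0 by (simp flip: P_def)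
  moreover have "(mat 1 - Q) ** F0 ** (mat 1 - Q) = 0"
    using F0 by (simp flip: Q_def)
  moreover have "(mat 1 - Q) ** D0 ** (mat 1 - Q)
      = (mat 1 - Q) ** F0 ** (mat 1 - Q) - (mat 1 - Q) ** E0 ** (mat 1 - Q)"
    by (simp only: D0_def matrix_mult_diff_distrib_left[of _ F0 E0]
        matrix_mult_diff_distrib_right[of "(mat 1 - Q) ** F0"])
  ultimately have "(mat 1 - Q) ** D0 ** (mat 1 - Q) = 0"
    by simp
  then have D0: "D0 = Q ** D0 + D0 ** Q - Q ** D0 ** Q"
    by (simp add: matrix_distribs algebra_simps)
  have "dual_matrix (F - E) D0 ** dual_matrix H (- (H ** D0 ** H)) ** dual_matrix (F - E) D0
      = dual_matrix (F - E) D0"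
  proof -
    have HD': "X ** H ** (F - E) = X ** (Q - P)" for X :: "real^'n^'n"
      by (simp add: HD flip: matrix_mul_assoc)
    have QD0: "(Q - P) ** D0 = Q ** D0" "D0 ** (Q - P) = D0 ** Q"
      by (simp_all add: matrix_distribs P0)
    \<comment> \<open>This is the infinitesimal part of the triple product. As \<open>P\<close>
      annihilates \<open>D0\<close> on both sides, \<open>Q - P\<close> acts on \<open>D0\<close>
      like \<open>Q\<close>.\<close>
    have "(F - E) ** H ** D0 + ((F - E) ** (- (H ** D0 ** H)) + D0 ** H) ** (F - E)
      = (Q - P) ** D0 + D0 ** (Q - P) - (Q - P) ** D0 ** (Q - P)"
      by (simp add: matrix_mul_assoc DH HD' matrix_mult_add_distrib_right
          matrix_mult_diff_distrib_right[of _ _ "F - E"])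
    also have "\<dots> = Q ** D0 + D0 ** Q - Q ** D0 ** Q"
      by (simp add: QD0 flip: matrix_mul_assoc)
    also have "\<dots> = D0"
      by (rule D0[symmetric])
    finally have *: "(F - E) ** H ** D0 + ((F - E) ** (- (H ** D0 ** H)) + D0 ** H) ** (F - E) = D0" .
    show ?thesis
      unfolding dual_matrix_mult dual_matrix_eq_iff by (intro conjI *) (simp add: DH DHD)
  qed
  then show ?thesis
    unfolding D0_def by (rule regular_imp_has_DMPGI)
qed

theorem theorem3p11:
  fixes E E0 F F0 :: "real^'n^'n"
  assumes "dual_matrix E E0 \<in> dual_CM" and "dual_matrix F F0 \<in> dual_CM"
  shows "dual_matrix E E0 \<le>\<^sup>G\<^sup># dual_matrix F F0 \<longleftrightarrow>
    dual_matrix E E0 \<le>\<^sup>D dual_matrix F F0 \<and>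
    E ** F = F ** E \<and>
    (F0 - E0) ** E ** E\<^sup># = 0 \<and>
    E ** E\<^sup># ** (F0 - E0) = 0"
proof -
  obtain E: "has_DMPGI (dual_matrix E E0)" "is_group_inverse E (E\<^sup>#)"
    "(mat 1 - E ** E\<^sup>#) ** E0 ** (mat 1 - E ** E\<^sup>#) = 0"
    using assms(1) by (rule dual_CM_E)
  obtain F: "has_DMPGI (dual_matrix F F0)" "is_group_inverse F (F\<^sup>#)"
    "(mat 1 - F ** F\<^sup>#) ** F0 ** (mat 1 - F ** F\<^sup>#) = 0"
    using assms(2) by (rule dual_CM_E)
  \<comment> \<open>The projector \<open>E ** E\<^sup>#\<close> serves as both \<open>P\<close> and
    \<open>Q\<close> in \<open>minus_leI\<close>.\<close>
  have "E \<le>\<^sup>- F" if "E ** F = E ** E" "F ** E = E ** E"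
  proof (rule minus_leI)
    have G: "E ** E\<^sup># ** E = E" "E ** E\<^sup># = E\<^sup># ** E"
      using E by (auto simp: is_group_inverse_def)
    show "E ** E\<^sup># ** E = E" "E ** E\<^sup># ** F = E" "F ** (E ** E\<^sup>#) = E"
      using G that by (metis matrix_mul_assoc)+
  qed
  then have "(E ** F = E ** E \<and> F ** E = E ** E) \<longleftrightarrow> (E \<le>\<^sup>- F \<and> E ** F = F ** E)"
    using minus_le_commute_imp[OF _ _ F(2)] by metis
  moreover have "has_DMPGI (dual_matrix (F - E) (F0 - E0))"
    if "E ** F = E ** E" "F ** E = E ** E"
      "(F0 - E0) ** E ** E\<^sup># = 0" "E ** E\<^sup># ** (F0 - E0) = 0"
    using E(2) F(2) E(3) F(3) that by (rule sharp_imp_difference_regular)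
  ultimately show ?thesis
    unfolding G_sharp_le_iff[OF E(2) assms] dual_minus_le_def dual_matrix_diff std_dual_matrix
    using E(1) F(1) by blast
qed

end
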